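(* There exist Slitherlink signatures of multiplicity $4$ on arbitrarily large square grids; that is, for every positive integer $n_0$ there exist an integer $n \ge n_0$ and a cycle $C$ in the $n \times n$ grid such that exactly $4$ cycles in the $n \times n$ grid (including $C$ itself) have the same signature as $C$.
   Context: The $n \times n$ grid is the plane graph whose vertices are the integer points $(x, y)$ with $1 \le x \le n$ and $1 \le y \le n$ and whose edges are the unit segments between these points; its finite faces are the unit square cells. The signature of a cycle $C$ on the grid (also called a Slitherlink signature) is the function assigning to each cell the number of edges of that cell which belong to $C$. The multiplicity of a signature $S$ is the total number of cycles on the grid whose signature is $S$. *)

theory Defs
  imports "HOL-Library.FuncSet"
begin

type_synonym point = "int \<times> int"

text \<open>An undirected edge is represented by the set of its two end points.\<close>

definition grid_vertices :: "nat \<Rightarrow> point set" where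
  "grid_vertices n = {1..int n} \<times> {1..int n}"

definition grid_edges :: "nat \<Rightarrow> point set set" where
  "grid_edges n = {{p, q} | p q. p \<in> grid_vertices n \<and> q \<in> grid_vertices n \<and>
     \<bar>fst p - fst q\<bar> + \<bar>snd p - snd q\<bar> = 1}"

definition cyclic_edges :: "'a list \<Rightarrow> 'a set set" where
  "cyclic_edges vs = {{vs ! i, vs ! (Suc i mod length vs)} | i. i < length vs}"

text \<open>A cycle is a subgraph, identified with its edge set, so that the starting point and
  the direction of traversal do not matter when cycles are counted.\<close>

definition grid_cycle :: "nat \<Rightarrow> point set set \<Rightarrow> bool" where
  "grid_cycle n C \<longleftrightarrow> C \<subseteq> grid_edges n \<and>
     (\<exists>vs. 3 \<le> length vs \<and> distinct vs \<and> C = cyclic_edges vs)"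

text \<open>A cell is represented by its lower left corner.\<close>

definition grid_cells :: "nat \<Rightarrow> point set" where
  "grid_cells n = {1..<int n} \<times> {1..<int n}"

fun cell_edges :: "point \<Rightarrow> point set set" where
  "cell_edges (x, y) =
     {{(x, y), (x + 1, y)}, {(x, y + 1), (x + 1, y + 1)},
      {(x, y), (x, y + 1)}, {(x + 1, y), (x + 1, y + 1)}}"

text \<open>The restriction to the cells of the grid makes equality of signatures mean equality
  on these cells.\<close>

definition signature :: "nat \<Rightarrow> point set set \<Rightarrow> point \<Rightarrow> nat" where
  "signature n C = (\<lambda>c\<in>grid_cells n. card (cell_edges c \<inter> C))"

definition signature_multiplicity :: "nat \<Rightarrow> (point \<Rightarrow> nat) \<Rightarrow> nat" where
  "signature_multiplicity n S = card {C. grid_cycle n C \<and> signature n C = S}"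

end

theory Submission
  imports Defs "HOL-Library.Product_Lexorder" "HOL-Library.Multiset"
begin

text \<open>If two cycles have the same signature, then the set of edges in which they differ meets every
  vertex star and every cell in an even number of edges. Such a set comes from a two-colouring of the
  \<open>n\<close> closed billiard paths through the midpoints of the edges: an edge belongs to it iff the two
  paths that cross in its midpoint have different colours. Four cycles on the \<open>11 \<times> 11\<close> grid, found by
  computer, differ from each other by recolouring the paths 1 and 2 together and the path 3. They are
  periodic along a stretch of the main diagonal, so that one period may be repeated arbitrarily often;
  all four remain cycles with equal signatures. On the enlarged grids the empty cells at the left border and a few cells in the corner
  exclude every other colouring.\<close>

text \<open>Vertex degrees and signatures are local, so they survive the repetition of a period by
  inspecting single stars and cells. Being one cycle rather than several is global, and this is the
  obstacle. It is overcome because the part below a fixed diagonal level is the same at every stage,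
  so that one finite search certifies every induction step. Path \<open>i\<close> is a rectangle
  around the main diagonal, with long sides at distance at most i - 1/2 in the coordinate x - y.
  Recolouring the paths 1, 2, 3 therefore affects only a thin band, in which, away from the two
  corners, the change depends on x - y alone. This is why a shift along the diagonal is compatible
  with the recolouring. Parity alone admits every colouring, 2^(n-1) different sets. Only the exact
  numbers of edges in cells cut this down to four.\<close>

subsection \<open>Connected two-regular graphs\<close>

lemma adjacent_unique:
  assumes "card {e \<in> E. v \<in> e} = 2" "{v, a} \<in> E" "{v, b} \<in> E" "{v, c} \<in> E"
    and "a \<noteq> b" "a \<noteq> v" "b \<noteq> v" "c \<noteq> v"
  shows "c = a \<or> c = b"
proof (rule ccontr)
  assume "\<not> ?thesis"
  then have "card {{v, a}, {v, b}, {v, c}} = 3"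
    using assms by (auto simp: doubleton_eq_iff card_insert_if)
  moreover have "card {{v, a}, {v, b}, {v, c}} \<le> card {e \<in> E. v \<in> e}"
    by (rule card_mono) (use assms in \<open>auto intro: card_ge_0_finite\<close>)
  ultimately show False
    using assms(1) by simp
qed

lemma second_neighbour:
  assumes "card {e \<in> E. v \<in> e} = 2" "\<And>e. e \<in> E \<Longrightarrow> card e = 2" "{v, a} \<in> E"
  obtains b where "{v, b} \<in> E" "b \<noteq> a" "b \<noteq> v"
proof -
  obtain e where e: "e \<in> E" "v \<in> e" "e \<noteq> {v, a}"
    using assms(1,3) by (auto simp: card_2_iff)
  then obtain b where "e = {v, b}" "b \<noteq> v"
    using assms(2)[OF e(1)] by (auto simp: card_2_iff insert_commute)
  with e that show thesis
    by auto
qed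

lemma Union_cyclic_edges: "\<Union>(cyclic_edges vs) \<subseteq> set vs"
proof -
  have "vs ! (Suc i mod length vs) \<in> set vs" if "i < length vs" for i
    using that by (intro nth_mem mod_less_divisor) auto
  then show ?thesis
    unfolding cyclic_edges_def by auto
qed

lemma nth_neighbours_in_cyclic_edges:
  assumes "i < length vs"
  shows "{vs ! i, vs ! (Suc i mod length vs)} \<in> cyclic_edges vs"
    and "{vs ! i, vs ! (if i = 0 then length vs - 1 else i - 1)} \<in> cyclic_edges vs"
proof -
  show "{vs ! i, vs ! (Suc i mod length vs)} \<in> cyclic_edges vs"
    using assms unfolding cyclic_edges_def by auto
  show "{vs ! i, vs ! (if i = 0 then length vs - 1 else i - 1)} \<in> cyclic_edges vs"
  proof (cases "i = 0")
    case True
    then show ?thesis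
      using assms unfolding cyclic_edges_def
      by (auto intro!: exI[of _ "length vs - 1"] simp: insert_commute)
  next
    case False
    then show ?thesis
      using assms unfolding cyclic_edges_def
      by (auto intro!: exI[of _ "i - 1"] simp: insert_commute)
  qed
qed

lemma nth_neighbours_distinct:
  assumes "distinct vs" "3 \<le> length vs" "i < length vs"
  shows "vs ! (Suc i mod length vs) \<noteq> vs ! i"
    and "vs ! (if i = 0 then length vs - 1 else i - 1) \<noteq> vs ! i"
    and "vs ! (Suc i mod length vs) \<noteq> vs ! (if i = 0 then length vs - 1 else i - 1)"
proof -
  define j where "j = Suc i mod length vs"
  define k where "k = (if i = 0 then length vs - 1 else i - 1)"
  have "j < length vs" "k < length vs" "j \<noteq> i" "k \<noteq> i" "j \<noteq> k"
    using assms(2,3) unfolding j_def k_def by (auto simp: mod_Suc)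
  then show "vs ! j \<noteq> vs ! i" "vs ! k \<noteq> vs ! i" "vs ! j \<noteq> vs ! k"
    using assms(1,3) by (simp_all add: nth_eq_iff_index_eq)
qed

lemma cyclic_edges_at_nth:
  assumes "distinct vs" "3 \<le> length vs" "i < length vs"
  shows "{e \<in> cyclic_edges vs. vs ! i \<in> e} =
    {{vs ! i, vs ! (Suc i mod length vs)}, {vs ! i, vs ! (if i = 0 then length vs - 1 else i - 1)}}"
    (is "?L = ?R")
proof
  show "?R \<subseteq> ?L"
    using nth_neighbours_in_cyclic_edges[OF assms(3)] by auto
  show "?L \<subseteq> ?R"
  proof
    fix e
    assume "e \<in> ?L"
    then obtain j where j: "j < length vs" "e = {vs ! j, vs ! (Suc j mod length vs)}" "vs ! i \<in> e"
      unfolding cyclic_edges_def by auto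
    moreover from j(1) have "Suc j mod length vs < length vs"
      by (intro mod_less_divisor) auto
    ultimately have "i = j \<or> i = Suc j mod length vs"
      using assms(1,3) by (auto simp: nth_eq_iff_index_eq)
    then show "e \<in> ?R"
    proof
      assume "i = Suc j mod length vs"
      then have "j = (if i = 0 then length vs - 1 else i - 1)"
        using j(1) by (auto simp: mod_Suc split: if_splits)
      then show ?thesis
        using j(2) \<open>i = Suc j mod length vs\<close> by (auto simp: insert_commute)
    qed (use j in simp)
  qed
qed

lemma even_degree_cyclic_edges:
  assumes "distinct vs" "3 \<le> length vs"
  shows "even (card {e \<in> cyclic_edges vs. v \<in> e})"
proof (cases "v \<in> set vs")
  case True
  then obtain i where "i < length vs" "v = vs ! i"
    by (auto simp: in_set_conv_nth)
  then show ?thesis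
    using cyclic_edges_at_nth[OF assms] nth_neighbours_distinct[OF assms, of i]
    by (simp add: doubleton_eq_iff)
next
  case False
  then have no: "{e \<in> cyclic_edges vs. v \<in> e} = {}"
    using Union_cyclic_edges[of vs] by auto
  show ?thesis
    unfolding no by simp
qed

text \<open>A path of maximal length closes up, because each of its end points has a second neighbour
  and every inner vertex of the path has already met both of its neighbours.\<close>

lemma connected_two_regular_is_cycle:
  fixes E :: "'a set set"
  assumes fin: "finite E" and ne: "E \<noteq> {}"
    and edge: "\<And>e. e \<in> E \<Longrightarrow> card e = 2"
    and regular: "\<And>v. v \<in> \<Union>E \<Longrightarrow> card {e \<in> E. v \<in> e} = 2"
    and connected: "\<And>S. S \<noteq> {} \<Longrightarrow> S \<subseteq> \<Union>E \<Longrightarrow>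
      (\<And>p q. {p, q} \<in> E \<Longrightarrow> p \<in> S \<Longrightarrow> q \<in> S) \<Longrightarrow> \<Union>E \<subseteq> S"
  shows "\<exists>vs. 3 \<le> length vs \<and> distinct vs \<and> E = cyclic_edges vs"
proof -
  define path where "path vs \<longleftrightarrow> distinct vs \<and> set vs \<subseteq> \<Union>E \<and>
    successively (\<lambda>p q. {p, q} \<in> E) vs" for vs
  have finite_vertices: "finite (\<Union>E)"
    using fin edge by (intro finite_Union) (auto intro: card_ge_0_finite)
  have bound: "length vs < Suc (card (\<Union>E))" if "path vs" for vs
    using that card_mono[OF finite_vertices, of "set vs"]
    unfolding path_def by (auto simp: distinct_card)
  obtain e where "e \<in> E"
    using ne by auto
  moreover from this obtain p q where "e = {p, q}" "p \<noteq> q"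
    using edge by (meson card_2_iff)
  ultimately have start: "path [p, q]"
    unfolding path_def by auto
  obtain vs where vs: "path vs" and maximal: "\<And>ws. path ws \<Longrightarrow> length ws \<le> length vs"
    using ex_has_greatest_nat[of path "[p, q]" length] start bound by blast
  have loop: "a \<noteq> b" if "{a, b} \<in> E" for a b
    using edge[OF that] by auto
  define L where "L = length vs"
  have L2: "L \<ge> 2"
    using maximal[OF start] unfolding L_def by simp
  have step: "{vs ! i, vs ! Suc i} \<in> E" if "Suc i < L" for i
    using vs that unfolding path_def L_def successively_conv_nth by auto
  have dist: "vs ! i = vs ! j \<longleftrightarrow> i = j" if "i < L" "j < L" for i j
    using vs that unfolding path_def L_def by (simp add: nth_eq_iff_index_eq)
  have verts: "vs ! i \<in> \<Union>E" if "i < L" for i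
    using vs that nth_mem unfolding path_def L_def by blast
  have "{vs ! (L - 1), vs ! (L - 2)} \<in> E"
    using step[of "L - 2"] L2 by (simp add: insert_commute Suc_diff_Suc numeral_2_eq_2)
  then obtain w where w: "{vs ! (L - 1), w} \<in> E" "w \<noteq> vs ! (L - 2)" "w \<noteq> vs ! (L - 1)"
    using second_neighbour[OF regular[OF verts] edge, of "L - 1"] L2 by auto
  have "w \<in> set vs"
  proof (rule ccontr)
    assume "w \<notin> set vs"
    moreover have "vs \<noteq> []"
      using L2 unfolding L_def by auto
    ultimately have "path (vs @ [w])"
      using vs w(1) unfolding path_def L_def
      by (auto simp: successively_append_iff last_conv_nth)
    from maximal[OF this] show False
      by simp
  qed
  then obtain i where i: "i < L" "w = vs ! i"
    unfolding L_def by (auto simp: in_set_conv_nth)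
  have i_bound: "Suc i < L - 1"
  proof -
    have "i \<noteq> L - 1" "i \<noteq> L - 2"
      using i w by auto
    then show ?thesis
      using i(1) by linarith
  qed
  have "i = 0"
  proof (rule ccontr)
    assume "i \<noteq> 0"
    then have "{vs ! i, vs ! (i - 1)} \<in> E"
      using step[of "i - 1"] i(1) by (simp add: insert_commute)
    moreover have "{vs ! i, vs ! Suc i} \<in> E" "{vs ! i, vs ! (L - 1)} \<in> E"
      using step[of i] i_bound w i by (auto simp: insert_commute)
    ultimately show False
      using adjacent_unique[OF regular[OF verts[OF i(1)]], of "vs ! (i - 1)" "vs ! Suc i" "vs ! (L - 1)"]
        dist i_bound \<open>i \<noteq> 0\<close> by auto
  qed
  then have L3: "3 \<le> length vs" and close: "{vs ! (L - 1), vs ! 0} \<in> E"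
    using i_bound w(1) i(2) unfolding L_def by auto
  have dvs: "distinct vs"
    using vs unfolding path_def by simp
  have sub: "cyclic_edges vs \<subseteq> E"
  proof
    fix e
    assume "e \<in> cyclic_edges vs"
    then obtain j where j: "j < L" "e = {vs ! j, vs ! (Suc j mod L)}"
      unfolding cyclic_edges_def L_def by auto
    show "e \<in> E"
    proof (cases "Suc j < L")
      case False
      then have "j = L - 1"
        using j(1) by simp
      then show ?thesis
        using j close L2 by simp
    qed (use j step in simp)
  qed
  \<comment> \<open>Both edge sets have exactly two edges at a vertex of the list, so the inclusion
    is an equality there.\<close>
  have at: "e \<in> cyclic_edges vs" if e: "e \<in> E" "v \<in> e" and v: "v \<in> set vs" for e v
  proof -
    obtain j where j: "j < length vs" "v = vs ! j"
      using v by (auto simp: in_set_conv_nth)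
    have "card {e \<in> cyclic_edges vs. v \<in> e} = 2"
      using cyclic_edges_at_nth[OF dvs L3 j(1)] nth_neighbours_distinct[OF dvs L3 j(1)] j(2)
      by (simp add: doubleton_eq_iff)
    moreover have "card {e \<in> E. v \<in> e} = 2" "finite {e \<in> E. v \<in> e}"
      using regular e fin by auto
    ultimately have "{e \<in> cyclic_edges vs. v \<in> e} = {e \<in> E. v \<in> e}"
      using sub by (intro card_subset_eq) auto
    then show ?thesis
      using e by auto
  qed
  have "\<Union>E \<subseteq> set vs"
  proof (rule connected)
    fix p q
    assume "{p, q} \<in> E" "p \<in> set vs"
    then have "{p, q} \<in> cyclic_edges vs"
      using at[of "{p, q}" p] by simp
    then show "q \<in> set vs"
      using Union_cyclic_edges[of vs] by auto
  qed (use vs L3 in \<open>auto simp: path_def\<close>)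
  then have "E \<subseteq> cyclic_edges vs"
  proof -
    have "e \<in> cyclic_edges vs" if "e \<in> E" for e
    proof -
      obtain v where "v \<in> e"
        using edge[OF \<open>e \<in> E\<close>] by (auto simp: card_2_iff)
      then show ?thesis
        using at that \<open>\<Union>E \<subseteq> set vs\<close> by auto
    qed
    then show ?thesis
      by auto
  qed
  with sub dvs L3 show ?thesis
    by auto
qed

subsection \<open>Sets of unit segments\<close>

text \<open>A triple \<open>(v, x, y)\<close> stands for the unit segment from \<open>(x, y)\<close> upwards if \<open>v\<close> holds, and from
  \<open>(x, y)\<close> to the right otherwise.\<close>

type_synonym segment = "bool \<times> int \<times> int"

fun tip :: "segment \<Rightarrow> point" where
  "tip (v, x, y) = (if v then (x, y + 1) else (x + 1, y))"

definition edge :: "segment \<Rightarrow> point set" where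
  "edge e = {snd e, tip e}"

definition segments :: "nat \<Rightarrow> segment set" where
  "segments n = {e. snd e \<in> grid_vertices n \<and> tip e \<in> grid_vertices n}"

fun star :: "point \<Rightarrow> segment list" where
  "star (x, y) = [(False, x, y), (False, x - 1, y), (True, x, y), (True, x, y - 1)]"

fun sides :: "point \<Rightarrow> segment list" where
  "sides (x, y) = [(False, x, y), (False, x, y + 1), (True, x, y), (True, x + 1, y)]"

text \<open>A sum over an explicit list instead of a cardinality: for the four segments of a star or
  a cell, simplification turns it into arithmetic with four truth values.\<close>

definition hits :: "segment set \<Rightarrow> segment list \<Rightarrow> nat" where
  "hits X es = (\<Sum>e\<leftarrow>es. of_bool (e \<in> X))"

lemma inj_edge: "inj edge"
  by (rule injI) (auto simp: edge_def doubleton_eq_iff split: if_splits)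

lemma mem_segments:
  "(v, x, y) \<in> segments n \<longleftrightarrow>
    1 \<le> x \<and> 1 \<le> y \<and> (if v then x \<le> int n \<and> y < int n else x < int n \<and> y \<le> int n)"
  by (auto simp: segments_def grid_vertices_def)

lemma finite_segments: "finite (segments n)"
proof (rule finite_subset)
  show "segments n \<subseteq> UNIV \<times> grid_vertices n"
    by (auto simp: segments_def)
qed (simp add: grid_vertices_def)

lemma grid_edges_eq: "grid_edges n = edge ` segments n"
proof
  show "edge ` segments n \<subseteq> grid_edges n"
  proof
    fix a
    assume "a \<in> edge ` segments n"
    then obtain e where e: "e \<in> segments n" "a = {snd e, tip e}"
      by (auto simp: edge_def)
    have "\<bar>fst (snd e) - fst (tip e)\<bar> + \<bar>snd (snd e) - snd (tip e)\<bar> = 1"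
      by (cases e) simp
    with e show "a \<in> grid_edges n"
      unfolding grid_edges_def segments_def mem_Collect_eq
      by (intro exI[of _ "snd e"] exI[of _ "tip e"]) simp
  qed
  show "grid_edges n \<subseteq> edge ` segments n"
  proof
    fix a
    assume "a \<in> grid_edges n"
    then obtain x y z w where a: "a = {(x, y), (z, w)}" "(x, y) \<in> grid_vertices n"
        "(z, w) \<in> grid_vertices n" "\<bar>x - z\<bar> + \<bar>y - w\<bar> = 1"
      unfolding grid_edges_def by auto
    then consider "z = x + 1" "w = y" | "x = z + 1" "w = y" | "w = y + 1" "z = x" | "y = w + 1" "z = x"
      by linarith
    then show "a \<in> edge ` segments n"
    proof cases
      case 1
      then show ?thesis
        using a by (intro image_eqI[of _ _ "(False, x, y)"]) (auto simp: edge_def segments_def)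
    next
      case 2
      then show ?thesis
        using a by (intro image_eqI[of _ _ "(False, z, w)"]) (auto simp: edge_def segments_def)
    next
      case 3
      then show ?thesis
        using a by (intro image_eqI[of _ _ "(True, x, y)"]) (auto simp: edge_def segments_def)
    next
      case 4
      then show ?thesis
        using a by (intro image_eqI[of _ _ "(True, z, w)"]) (auto simp: edge_def segments_def)
    qed
  qed
qed

lemma card_image_edge_Int:
  assumes "distinct es"
  shows "card (edge ` set es \<inter> edge ` X) = hits X es"
proof -
  have "edge ` set es \<inter> edge ` X = edge ` (set es \<inter> X)"
    by (simp add: image_Int[OF inj_edge])
  moreover have "card (set es \<inter> X) = hits X es"
    using assms by (induction es) (auto simp: hits_def Int_insert_left)
  ultimately show ?thesis
    using inj_edge by (simp add: card_image inj_on_subset)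
qed

lemma card_cell_edges: "card (cell_edges p \<inter> edge ` X) = hits X (sides p)"
proof -
  have "cell_edges p = edge ` set (sides p)" "distinct (sides p)"
    by (cases p; auto simp: edge_def)+
  then show ?thesis
    using card_image_edge_Int by metis
qed

lemma card_degree: "card {e \<in> edge ` X. p \<in> e} = hits X (star p)"
proof -
  have "{e \<in> edge ` X. p \<in> e} = edge ` set (star p) \<inter> edge ` X"
  proof -
    have "p \<in> edge e \<longleftrightarrow> e \<in> set (star p)" for e
      by (cases e; cases p) (auto simp: edge_def)
    moreover have "edge e \<in> edge ` set (star p) \<longleftrightarrow> e \<in> set (star p)" for e
      by (simp add: inj_image_mem_iff[OF inj_edge])
    ultimately show ?thesis
      by auto
  qed
  moreover have "distinct (star p)"
    by (cases p) auto
  ultimately show ?thesis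
    using card_image_edge_Int by metis
qed

definition linked :: "segment set \<Rightarrow> (point \<times> point) set" where
  "linked X = {(p, q). {p, q} \<in> edge ` X}\<^sup>*"

lemma linked_refl [simp]: "(p, p) \<in> linked X"
  by (simp add: linked_def)

lemma linked_trans: "(p, q) \<in> linked X \<Longrightarrow> (q, r) \<in> linked X \<Longrightarrow> (p, r) \<in> linked X"
  unfolding linked_def by (rule rtrancl_trans)

lemma linked_sym: "(p, q) \<in> linked X \<Longrightarrow> (q, p) \<in> linked X"
proof -
  have "sym {(p, q). {p, q} \<in> edge ` X}"
    by (auto simp: sym_def insert_commute)
  then show "(p, q) \<in> linked X \<Longrightarrow> (q, p) \<in> linked X"
    unfolding linked_def using sym_rtrancl symD by metis
qed

lemma linked_tip: "e \<in> X \<Longrightarrow> (snd e, tip e) \<in> linked X"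
  unfolding linked_def by (rule r_into_rtrancl) (auto simp: edge_def)

lemma linked_closed:
  assumes "(p, q) \<in> linked X" "p \<in> S" "\<And>p q. {p, q} \<in> edge ` X \<Longrightarrow> p \<in> S \<Longrightarrow> q \<in> S"
  shows "q \<in> S"
  using assms(1) unfolding linked_def by (induction rule: rtrancl_induct) (use assms in auto)

lemma grid_cycle_edge_image:
  assumes "X \<subseteq> segments n" "X \<noteq> {}"
    and degree: "\<And>p. hits X (star p) \<in> {0, 2}"
    and conn: "\<And>a b. a \<in> X \<Longrightarrow> b \<in> X \<Longrightarrow> (snd a, snd b) \<in> linked X"
  shows "grid_cycle n (edge ` X)"
proof -
  have fin: "finite X"
    using assms(1) finite_segments finite_subset by blast
  have "\<exists>vs. 3 \<le> length vs \<and> distinct vs \<and> edge ` X = cyclic_edges vs"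
  proof (rule connected_two_regular_is_cycle)
    show "card a = 2" if "a \<in> edge ` X" for a
      using that by (auto simp: edge_def card_insert_if)
    show "card {a \<in> edge ` X. p \<in> a} = 2" if "p \<in> \<Union>(edge ` X)" for p
    proof -
      have "card {a \<in> edge ` X. p \<in> a} \<noteq> 0"
        using that fin by auto
      then show ?thesis
        using degree[of p] by (simp add: card_degree)
    qed
    fix S
    assume S: "S \<noteq> {}" "S \<subseteq> \<Union>(edge ` X)"
      and closed: "\<And>p q. {p, q} \<in> edge ` X \<Longrightarrow> p \<in> S \<Longrightarrow> q \<in> S"
    obtain c where c: "c \<in> X"
      using assms(2) by auto
    have reach: "(snd c, p) \<in> linked X" if "p \<in> \<Union>(edge ` X)" for p
    proof -
      obtain e where "e \<in> X" "p = snd e \<or> p = tip e"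
        using \<open>p \<in> \<Union>(edge ` X)\<close> by (auto simp: edge_def)
      then show ?thesis
        using conn[OF c] linked_tip linked_trans by metis
    qed
    obtain p where "p \<in> S"
      using S by auto
    show "\<Union>(edge ` X) \<subseteq> S"
    proof
      fix q
      assume "q \<in> \<Union>(edge ` X)"
      then have "(p, q) \<in> linked X"
        using reach \<open>p \<in> S\<close> S(2) linked_sym linked_trans by (metis subsetD)
      then show "q \<in> S"
        using \<open>p \<in> S\<close> closed by (rule linked_closed)
    qed
  qed (use fin assms(2) in auto)
  moreover have "edge ` X \<subseteq> grid_edges n"
    using assms(1) by (auto simp: grid_edges_eq)
  ultimately show ?thesis
    by (simp add: grid_cycle_def)
qed

subsection \<open>Graph search\<close>

fun peel :: "point \<Rightarrow> segment list \<Rightarrow> point list \<times> segment list" where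
  "peel p [] = ([], [])"
| "peel p (e # es) = (case peel p es of (ps, rs) \<Rightarrow>
    if snd e = p then (tip e # ps, rs) else if tip e = p then (snd e # ps, rs) else (ps, e # rs))"

text \<open>The result consists of the segments that were never reached. The number bounds the steps
  and makes the recursion structural; \<open>None\<close> means that it was too small. Every segment
  is removed once and adds one point, so the number of starting points plus the number of segments
  is always enough.\<close>

fun explore :: "nat \<Rightarrow> point list \<Rightarrow> segment list \<Rightarrow> segment list option" where
  "explore m [] es = Some es"
| "explore 0 (p # ps) es = None"
| "explore (Suc m) (p # ps) es = (case peel p es of (qs, rs) \<Rightarrow> explore m (qs @ ps) rs)"

lemma peel_eq: "peel p es = (map (\<lambda>e. if snd e = p then tip e else snd e)
    (filter (\<lambda>e. snd e = p \<or> tip e = p) es), filter (\<lambda>e. snd e \<noteq> p \<and> tip e \<noteq> p) es)"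
  by (induction es) auto

lemma set_peel:
  assumes "peel p es = (qs, rs)"
  shows "set qs = (\<lambda>e. if snd e = p then tip e else snd e) ` {e \<in> set es. snd e = p \<or> tip e = p}"
    "set rs = {e \<in> set es. snd e \<noteq> p \<and> tip e \<noteq> p}"
  using assms unfolding peel_eq prod.inject by (auto simp only: set_map set_filter)

lemma peel_separated:
  assumes "peel p es = (qs, rs)"
  shows "set rs \<subseteq> set es"
    and "e \<in> set rs \<Longrightarrow> p \<notin> {snd e, tip e}"
    and "e \<in> set es - set rs \<Longrightarrow> {snd e, tip e} \<subseteq> insert p (set qs)"
proof -
  note sets = set_peel[OF assms]
  show "set rs \<subseteq> set es" and "e \<in> set rs \<Longrightarrow> p \<notin> {snd e, tip e}"
    unfolding sets by auto
  assume "e \<in> set es - set rs"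
  then have e: "e \<in> {e \<in> set es. snd e = p \<or> tip e = p}"
    unfolding sets by auto
  then have "(if snd e = p then tip e else snd e) \<in> set qs"
    unfolding sets by (rule imageI)
  with e show "{snd e, tip e} \<subseteq> insert p (set qs)"
    by (cases "snd e = p") auto
qed

lemma peel_linked:
  assumes "peel p es = (qs, rs)" "set es \<subseteq> X"
  shows "q \<in> set qs \<Longrightarrow> (p, q) \<in> linked X"
    and "e \<in> set es - set rs \<Longrightarrow> (p, snd e) \<in> linked X"
proof -
  note sets = set_peel[OF assms(1)]
  have touch: "(p, tip e) \<in> linked X \<and> (p, snd e) \<in> linked X"
    if "e \<in> {e \<in> set es. snd e = p \<or> tip e = p}" for e
  proof -
    have "(snd e, tip e) \<in> linked X"
      using that assms(2) by (intro linked_tip) auto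
    then show ?thesis
      using that linked_sym linked_refl by (metis (mono_tags, lifting) mem_Collect_eq)
  qed
  show "(p, q) \<in> linked X" if q: "q \<in> set qs"
  proof -
    obtain e where "e \<in> {e \<in> set es. snd e = p \<or> tip e = p}" "q = (if snd e = p then tip e else snd e)"
      using q unfolding sets by blast
    then show ?thesis
      using touch[of e] by presburger
  qed
  show "(p, snd e) \<in> linked X" if "e \<in> set es - set rs"
  proof -
    have "e \<in> {e \<in> set es. snd e = p \<or> tip e = p}"
      using that unfolding sets by auto
    then show ?thesis
      using touch by blast
  qed
qed

lemma explore_linked:
  assumes "explore m ps es = Some rs" "set es \<subseteq> X" "e \<in> set es - set rs"
  shows "\<exists>p\<in>set ps. (p, snd e) \<in> linked X"
  using assms
proof (induction m ps es rule: explore.induct)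
  case (3 m p ps es)
  obtain qs rs' where peel: "peel p es = (qs, rs')"
    by fastforce
  note linked = peel_linked[OF peel "3.prems"(2)]
  show ?case
  proof (cases "e \<in> set rs'")
    case True
    have "\<exists>q\<in>set (qs @ ps). (q, snd e) \<in> linked X"
      using "3.IH"[OF peel[symmetric]] True "3.prems" peel peel_separated(1)[OF peel] by auto
    then show ?thesis
      using linked(1) linked_trans by (metis Un_iff list.set_intros set_append)
  qed (use "3.prems"(3) linked(2) in auto)
qed simp_all

text \<open>Left-over segments share no end with removed ones. Hence the ends of the removed
  segments, together with the start, are closed under adjacency, which makes the search
  complete.\<close>

lemma explore_separated:
  assumes "explore m ps es = Some rs"
  shows "set rs \<subseteq> set es \<and> (\<forall>e\<in>set rs. \<forall>p\<in>set ps. p \<notin> {snd e, tip e}) \<and>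
    (\<forall>e\<in>set rs. \<forall>e'\<in>set es - set rs. {snd e, tip e} \<inter> {snd e', tip e'} = {})"
  using assms
proof (induction m ps es rule: explore.induct)
  case (3 m p ps es)
  obtain qs rs' where peel: "peel p es = (qs, rs')"
    by fastforce
  note sep = peel_separated[OF peel]
  have IH: "set rs \<subseteq> set rs'" "\<forall>e\<in>set rs. \<forall>p\<in>set (qs @ ps). p \<notin> {snd e, tip e}"
      "\<forall>e\<in>set rs. \<forall>e'\<in>set rs' - set rs. {snd e, tip e} \<inter> {snd e', tip e'} = {}"
    using "3.IH"[OF peel[symmetric]] "3.prems" peel by auto
  have p: "p \<notin> {snd e, tip e}" if "e \<in> set rs" for e
    using sep(2) IH(1) that by blast
  have "{snd e, tip e} \<inter> {snd e', tip e'} = {}" if e: "e \<in> set rs" "e' \<in> set es - set rs" for e e'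
  proof (cases "e' \<in> set rs'")
    case False
    then have "{snd e', tip e'} \<subseteq> insert p (set qs)"
      using sep(3)[of e'] e(2) by blast
    moreover have "{snd e, tip e} \<inter> insert p (set qs) = {}"
      using IH(2) p[OF e(1)] e(1) by auto
    ultimately show ?thesis
      by blast
  qed (use IH e in blast)
  moreover have "set rs \<subseteq> set es"
    using IH(1) sep(1) by blast
  ultimately show ?case
    using IH(2) p by auto
qed auto

lemma explore_complete:
  assumes "explore m [p] es = Some rs" "(p, q) \<in> linked (set es)"
  shows "q = p \<or> (\<exists>e\<in>set es - set rs. q = snd e \<or> q = tip e)"
proof -
  note sep = explore_separated[OF assms(1)]
  let ?S = "insert p (\<Union>e\<in>set es - set rs. {snd e, tip e})"
  have "q \<in> ?S"
    using assms(2)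
  proof (rule linked_closed)
    fix a b
    assume "{a, b} \<in> edge ` set es" and a: "a \<in> ?S"
    then obtain e where e: "e \<in> set es" "{a, b} = {snd e, tip e}"
      unfolding edge_def by blast
    have "e \<notin> set rs"
    proof
      assume "e \<in> set rs"
      then have "p \<notin> {snd e, tip e}" "\<forall>e'\<in>set es - set rs. {snd e, tip e} \<inter> {snd e', tip e'} = {}"
        using sep by simp_all
      then show False
        using e(2) a by blast
    qed
    then show "b \<in> ?S"
      using e by blast
  qed simp
  then show ?thesis
    by blast
qed

subsection \<open>Repeating a period\<close>

text \<open>Copies the levels \<open>s - 3, \<dots>, s\<close> of \<open>x + y\<close> once more and moves everything above by \<open>(2, 2)\<close>.
  If \<open>seam s X\<close> holds, then every star and every cell of the result looks like one of \<open>X\<close>.\<close>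

definition stretch :: "int \<Rightarrow> segment set \<Rightarrow> segment set" where
  "stretch s X = {(v, x, y). (v, if x + y \<le> s then (x, y) else (x - 2, y - 2)) \<in> X}"

definition seam :: "int \<Rightarrow> segment set \<Rightarrow> bool" where
  "seam s X \<longleftrightarrow> (\<forall>v x y. x + y = s \<longrightarrow> (v, x, y) \<in> X \<longleftrightarrow> (v, x - 2, y - 2) \<in> X)"

lemma stretch_low: "x + y \<le> s \<Longrightarrow> (v, x, y) \<in> stretch s X \<longleftrightarrow> (v, x, y) \<in> X"
  by (simp add: stretch_def)

lemma stretch_high:
  assumes "seam s X" "s \<le> x + y"
  shows "(v, x, y) \<in> stretch s X \<longleftrightarrow> (v, x - 2, y - 2) \<in> X"
  using assms by (cases "x + y = s") (auto simp: stretch_def seam_def)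

text \<open>Both levels compared by \<open>seam\<close>, namely \<open>s\<close> and
  \<open>s - 4\<close>, lie in the unchanged part, so the repetition can be iterated at the same
  place.\<close>

lemma seam_stretch: "seam s X \<Longrightarrow> seam s (stretch s X)"
  by (auto simp: seam_def stretch_def)

text \<open>A star at level t = x + y uses the levels t - 1 and t, a cell the levels t and t + 1.
  Either all of them are at most \<open>s\<close> or all are at least \<open>s\<close>, and at
  \<open>s\<close> itself \<open>seam\<close> makes both readings agree. Hence the weak test here
  and the strict one for cells.\<close>

lemma hits_star_stretch:
  assumes "seam s X"
  shows "hits (stretch s X) (star (x, y)) =
    hits X (star (if x + y \<le> s then (x, y) else (x - 2, y - 2)))"
proof (cases "x + y \<le> s")
  case True
  then show ?thesis
    by (simp add: hits_def stretch_low)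
next
  case False
  then show ?thesis
    using assms by (simp add: hits_def stretch_high algebra_simps)
qed

lemma hits_sides_stretch:
  assumes "seam s X"
  shows "hits (stretch s X) (sides (x, y)) =
    hits X (sides (if x + y < s then (x, y) else (x - 2, y - 2)))"
proof (cases "x + y < s")
  case True
  then show ?thesis
    by (simp add: hits_def stretch_low)
next
  case False
  then show ?thesis
    using assms by (simp add: hits_def stretch_high algebra_simps)
qed

lemma stretch_subset_segments:
  assumes "X \<subseteq> segments n"
  shows "stretch s X \<subseteq> segments (n + 2)"
proof
  fix e
  assume e: "e \<in> stretch s X"
  obtain v x y where [simp]: "e = (v, x, y)"
    by (cases e)
  have "(v, if x + y \<le> s then (x, y) else (x - 2, y - 2)) \<in> segments n"
    using e assms by (auto simp: stretch_def)
  then show "e \<in> segments (n + 2)"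
    by (auto simp: mem_segments split: if_splits)
qed

abbreviation level :: "segment \<Rightarrow> int" where
  "level e \<equiv> fst (snd e) + snd (snd e)"

abbreviation shift :: "point \<Rightarrow> point" where
  "shift p \<equiv> (fst p + 2, snd p + 2)"

text \<open>A path in \<open>X\<close> is cut into its excursions below level \<open>s\<close> and the rest. The rest is shifted, and
  by \<open>low\<close> an excursion can be replaced by a connection between the shifts of its end points.\<close>

lemma stretch_connected:
  assumes seam: "seam s X"
    and conn: "\<And>a b. a \<in> X \<Longrightarrow> b \<in> X \<Longrightarrow> (snd a, snd b) \<in> linked X"
    and c: "c \<in> X" "level c = s"
    and low: "\<And>a b. a \<in> X \<Longrightarrow> b \<in> X \<Longrightarrow> level a = s \<Longrightarrow> level b = s \<Longrightarrow>
      (snd a, snd b) \<in> linked {e \<in> X. level e < s} \<Longrightarrow>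
      (shift (snd a), shift (snd b)) \<in> linked (stretch s X)"
    and new: "\<And>e. e \<in> stretch s X \<Longrightarrow> level e \<le> s + 4 \<Longrightarrow>
      \<exists>a\<in>X. level a = s \<and> (shift (snd a), snd e) \<in> linked (stretch s X)"
    and ab: "a \<in> stretch s X" "b \<in> stretch s X"
  shows "(snd a, snd b) \<in> linked (stretch s X)"
proof -
  let ?Y = "stretch s X" and ?A = "{e \<in> X. level e < s}"
  have high: "(shift (x, y), shift (tip (v, x, y))) \<in> linked ?Y" if "(v, x, y) \<in> X" "s \<le> x + y" for v x y
  proof -
    have "(v, x + 2, y + 2) \<in> ?Y"
      using that seam by (simp add: stretch_high)
    from linked_tip[OF this] show ?thesis
      by (simp add: algebra_simps split: if_splits)
  qed
  \<comment> \<open>The invariant carried along a path of \<open>X\<close>. A point up to level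
    \<open>s\<close> is represented by any segment of level \<open>s\<close> whose lower end is
    joined to it below the seam; \<open>low\<close> makes the choice irrelevant.\<close>
  define good where "good p \<longleftrightarrow>
      (if fst p + snd p \<le> s then \<exists>a\<in>X. level a = s \<and> (snd a, p) \<in> linked ?A \<and>
         (shift (snd c), shift (snd a)) \<in> linked ?Y
       else (shift (snd c), shift p) \<in> linked ?Y)" for p
  have good_low: "good p \<longleftrightarrow> (\<exists>a\<in>X. level a = s \<and> (snd a, p) \<in> linked ?A \<and>
      (shift (snd c), shift (snd a)) \<in> linked ?Y)" if "fst p + snd p \<le> s" for p
    using that by (simp add: good_def)
  have good_high: "good p \<longleftrightarrow> (shift (snd c), shift p) \<in> linked ?Y" if "s < fst p + snd p" for p
    using that by (simp add: good_def)
  have replace: "(p, q) \<in> linked Z \<longleftrightarrow> (p, q') \<in> linked Z" if "(q, q') \<in> linked Z" for p q q' Z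
    using that linked_sym linked_trans by blast
  have at_level: "good (snd a) \<longleftrightarrow> (shift (snd c), shift (snd a)) \<in> linked ?Y"
    if a: "a \<in> X" "level a = s" for a
  proof
    have le: "level a \<le> s"
      using a by simp
    assume "good (snd a)"
    then obtain a' where a': "a' \<in> X" "level a' = s" "(snd a', snd a) \<in> linked ?A"
        "(shift (snd c), shift (snd a')) \<in> linked ?Y"
      unfolding good_low[OF le] by blast
    then show "(shift (snd c), shift (snd a)) \<in> linked ?Y"
      using low[OF a'(1) a(1) a'(2) a(2) a'(3)] linked_trans by blast
  next
    have le: "level a \<le> s"
      using a by simp
    assume "(shift (snd c), shift (snd a)) \<in> linked ?Y"
    then show "good (snd a)"
      unfolding good_low[OF le] using a linked_refl by blast
  qed
  have step: "good (x, y) \<longleftrightarrow> good (tip (v, x, y))" if e: "(v, x, y) \<in> X" for v x y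
  proof -
    consider "x + y < s" | "x + y = s" | "x + y > s"
      by linarith
    then show ?thesis
    proof cases
      case 1
      then have "((x, y), tip (v, x, y)) \<in> linked ?A"
        using e linked_tip[of "(v, x, y)" ?A] by simp
      moreover have "fst (tip (v, x, y)) + snd (tip (v, x, y)) \<le> s" "fst (x, y) + snd (x, y) \<le> s"
        using 1 by auto
      ultimately show ?thesis
        by (simp only: good_low replace[of "(x, y)" "tip (v, x, y)" ?A])
    next
      case 2
      then have "good (x, y) \<longleftrightarrow> (shift (snd c), shift (x, y)) \<in> linked ?Y"
        using at_level[OF e] by simp
      also have "\<dots> \<longleftrightarrow> (shift (snd c), shift (tip (v, x, y))) \<in> linked ?Y"
        using 2 by (intro replace high e) simp
      also have "\<dots> \<longleftrightarrow> good (tip (v, x, y))"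
        using 2 by (intro good_high[symmetric]) auto
      finally show ?thesis .
    next
      case 3
      then have "good (x, y) \<longleftrightarrow> (shift (snd c), shift (x, y)) \<in> linked ?Y"
        by (intro good_high) simp
      also have "\<dots> \<longleftrightarrow> (shift (snd c), shift (tip (v, x, y))) \<in> linked ?Y"
        using 3 by (intro replace high e) simp
      also have "\<dots> \<longleftrightarrow> good (tip (v, x, y))"
        using 3 by (intro good_high[symmetric]) auto
      finally show ?thesis .
    qed
  qed
  have good: "good (snd e)" if "e \<in> X" for e
  proof -
    have "snd e \<in> {p. good p}"
    proof (rule linked_closed[OF conn[OF c(1) that]])
      show "snd c \<in> {p. good p}"
        using at_level[OF c] by simp
      fix p q
      assume "{p, q} \<in> edge ` X" "p \<in> {p. good p}"
      then obtain v x y where "(v, x, y) \<in> X" "{p, q} = {(x, y), tip (v, x, y)}"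
        by (auto simp: edge_def simp del: tip.simps)
      with \<open>p \<in> {p. good p}\<close> step[of v x y] show "q \<in> {p. good p}"
        by (auto simp: doubleton_eq_iff simp del: tip.simps)
    qed
    then show ?thesis
      by simp
  qed
  have "(shift (snd c), snd e) \<in> linked ?Y" if e: "e \<in> ?Y" for e
  \<comment> \<open>Above level \<open>s + 4\<close> a segment is the shift of one above level
    \<open>s\<close>, where \<open>good\<close> speaks of shifts directly.\<close>
  proof (cases "level e \<le> s + 4")
    case True
    then obtain a where a: "a \<in> X" "level a = s" "(shift (snd a), snd e) \<in> linked ?Y"
      using new e by blast
    then have "(shift (snd c), shift (snd a)) \<in> linked ?Y"
      using good[OF a(1)] at_level[OF a(1,2)] by simp
    then show ?thesis
      using a(3) linked_trans by metis
  next
    case False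
    obtain v x y where e_eq: "e = (v, x, y)"
      by (cases e)
    then have "(v, x - 2, y - 2) \<in> X"
      using e False seam by (simp add: stretch_high)
    from good[OF this] show ?thesis
      using False by (simp add: good_def e_eq)
  qed
  then show ?thesis
    using ab linked_sym linked_trans by metis
qed

subsection \<open>Bicycles and colourings\<close>

text \<open>The billiard path \<open>i\<close> lies on the lines \<open>x + y = i + 1/2\<close> and \<open>x - y = i - 1/2\<close> and is reflected half a
  unit outside the grid; \<open>mirror\<close> performs these reflections on the index \<open>i\<close>.\<close>

definition mirror :: "nat \<Rightarrow> int \<Rightarrow> int" where
  "mirror n i = (if i < 1 then 1 - i else if i > int n then 2 * int n + 1 - i else i)"

text \<open>The midpoint (x, y + 1/2) of a vertical segment lies on the lines of index x + y and x -
  y, the midpoint (x + 1/2, y) of a horizontal one on those of index x + y and x - y + 1.\<close>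

fun crossed :: "nat \<Rightarrow> (int \<Rightarrow> bool) \<Rightarrow> segment \<Rightarrow> bool" where
  "crossed n c (v, x, y) \<longleftrightarrow>
    c (mirror n (x + y)) \<noteq> c (mirror n (if v then x - y else x - y + 1))"

text \<open>The edges of the bottom row separate the paths \<open>i\<close> and \<open>i + 1\<close>, so they determine the colouring.\<close>

primrec row_colour :: "(segment \<Rightarrow> bool) \<Rightarrow> nat \<Rightarrow> bool" where
  "row_colour b 0 = False"
| "row_colour b (Suc m) = (row_colour b m \<noteq> b (False, int m + 1, 1))"

text \<open>The set lies in the cycle space and in the cut space of the grid: it is a bicycle. The
  bottom row determines it, since a star yields the vertical segment above its centre and a cell
  yields its upper side. The colouring read off the bottom row obeys the same recursion, so both
  agree row by row.\<close>

lemma bicycle_colouring: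
  fixes b :: "segment \<Rightarrow> bool"
  assumes supp: "\<And>e. b e \<Longrightarrow> e \<in> segments n"
    and star: "\<And>p. even (hits {e. b e} (star p))"
    and cell: "\<And>x y. 1 \<le> x \<Longrightarrow> x < int n \<Longrightarrow> 1 \<le> y \<Longrightarrow> y < int n \<Longrightarrow>
      even (hits {e. b e} (sides (x, y)))"
  shows "\<exists>c. \<forall>e\<in>segments n. b e \<longleftrightarrow> crossed n c e"
proof -
  define h where "h x y \<longleftrightarrow> b (False, x, y)" for x y
  define v where "v x y \<longleftrightarrow> b (True, x, y)" for x y
  define C where "C i = row_colour b (nat (mirror n i - 1))" for i
  have v_eq: "v x y \<longleftrightarrow> (h x y \<noteq> (h (x - 1) y \<noteq> v x (y - 1)))" for x y
    using star[of "(x, y)"] by (auto simp: hits_def h_def v_def)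
  have h_eq: "h x (y + 1) \<longleftrightarrow> (h x y \<noteq> (v x y \<noteq> v (x + 1) y))"
    if "1 \<le> x" "x < int n" "1 \<le> y" "y < int n" for x y
    using cell[OF that] by (auto simp: hits_def h_def v_def)
  have h_out: "\<not> h x y" if "x \<le> 0 \<or> int n \<le> x" for x y
    using supp[of "(False, x, y)"] that by (auto simp: h_def mem_segments)
  have v_out: "\<not> v x y" if "y \<le> 0" for x y
    using supp[of "(True, x, y)"] that by (auto simp: v_def mem_segments)
  have C_reflect: "C (1 - i) = C i" if "1 \<le> i" "i \<le> int n" for i
    using that by (simp add: C_def mirror_def)
  have C_reflect': "C (int n + i) = C (int n + 1 - i)" if "1 \<le> i" "i \<le> int n" for i
    using that by (simp add: C_def mirror_def)
  have C_step: "C (i + 1) \<longleftrightarrow> (C i \<noteq> h i 1)" if "1 \<le> i" "i < int n" for i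
  proof -
    have "nat i = Suc (nat (i - 1))" "int (nat (i - 1)) + 1 = i"
      using that by simp_all
    then show ?thesis
      using that by (simp add: C_def mirror_def h_def)
  qed
  \<comment> \<open>At x = 0 and x = n there is no horizontal segment, and there the reflection
    makes the two colours equal. Including these values lets the recursion run up to the
    border.\<close>
  have main: "(\<forall>x\<in>{0..int n}. h x (int m + 1) \<longleftrightarrow> C (x + int m + 1) \<noteq> C (x - int m)) \<and>
      (\<forall>x\<in>{1..int n}. v x (int m) \<longleftrightarrow> C (x + int m) \<noteq> C (x - int m))" if "m < n" for m
    using that
  proof (induction m)
    case 0
    have "h x 1 \<longleftrightarrow> C (x + 1) \<noteq> C x" if x: "0 \<le> x" "x \<le> int n" for x
    proof -
      consider "x = 0" | "1 \<le> x" "x < int n" | "x = int n"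
        using x by linarith
      then show ?thesis
      proof cases
        case 1
        then show ?thesis
          using h_out[of 0 1] C_reflect[of 1] 0 by simp
      next
        case 2
        then show ?thesis
          using C_step[of x] by auto
      next
        case 3
        then show ?thesis
          using h_out[of x 1] C_reflect'[of 1] 0 by simp
      qed
    qed
    then show ?case
      using v_out by auto
  next
    case (Suc m)
    define y where "y = int m + 1"
    have y: "1 \<le> y" "y < int n" "int m = y - 1"
      using Suc.prems by (auto simp: y_def)
    have IH: "h x y \<longleftrightarrow> C (x + y) \<noteq> C (x - y + 1)" if "0 \<le> x" "x \<le> int n" for x
      using Suc.IH Suc.prems that by (simp add: y_def algebra_simps)
    have IHv: "v x (y - 1) \<longleftrightarrow> C (x + y - 1) \<noteq> C (x - y + 1)" if "1 \<le> x" "x \<le> int n" for x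
      using Suc.IH Suc.prems that by (simp add: y_def algebra_simps)
    have v: "v x y \<longleftrightarrow> C (x + y) \<noteq> C (x - y)" if "1 \<le> x" "x \<le> int n" for x
    proof -
      have "h (x - 1) y \<longleftrightarrow> C (x + y - 1) \<noteq> C (x - y)"
        using IH[of "x - 1"] that by (simp add: algebra_simps)
      then show ?thesis
        using v_eq[of x y] IH[of x] IHv[of x] that by auto
    qed
    have "h x (y + 1) \<longleftrightarrow> C (x + y + 1) \<noteq> C (x - y)" if x: "0 \<le> x" "x \<le> int n" for x
    proof -
      consider "x = 0" | "1 \<le> x" "x < int n" | "x = int n"
        using x by linarith
      then show ?thesis
      proof cases
        case 1
        then show ?thesis
          using h_out[of 0 "y + 1"] C_reflect[of "y + 1"] y by simp
      next
        case 2
        have "v (x + 1) y \<longleftrightarrow> C (x + y + 1) \<noteq> C (x - y + 1)"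
          using v[of "x + 1"] 2 by (simp add: algebra_simps)
        then show ?thesis
          using h_eq[of x y] IH[of x] v[of x] 2 y by auto
      next
        case 3
        then show ?thesis
          using h_out[of x "y + 1"] C_reflect'[of "y + 1"] y by (simp add: algebra_simps)
      qed
    qed
    with v show ?case
      by (simp add: y_def algebra_simps)
  qed
  have "b (w, x, y) \<longleftrightarrow> C (x + y) \<noteq> C (if w then x - y else x - y + 1)" if "(w, x, y) \<in> segments n" for w x y
  proof (cases w)
    case True
    then show ?thesis
      using main[of "nat y"] that by (auto simp: mem_segments v_def)
  next
    case False
    define m where "m = nat (y - 1)"
    have m: "m < n" "int m = y - 1"
      using that False by (auto simp: m_def mem_segments)
    have "h x (int m + 1) \<longleftrightarrow> C (x + int m + 1) \<noteq> C (x - int m)"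
      using main[OF m(1)] that False by (simp add: mem_segments)
    then show ?thesis
      using False m(2) by (simp add: h_def algebra_simps)
  qed
  then have "\<forall>e\<in>segments n. b e \<longleftrightarrow> crossed n (\<lambda>i. row_colour b (nat (i - 1))) e"
    by (auto simp: C_def)
  then show ?thesis
    by blast
qed

lemma even_hits_difference:
  "even (hits {e. (e \<in> X) \<noteq> (e \<in> Z)} es) \<longleftrightarrow> even (hits X es + hits Z es)"
  by (induction es) (auto simp: hits_def)

lemma even_star_grid_cycle:
  assumes "grid_cycle n (edge ` X)"
  shows "even (hits X (star p))"
proof -
  obtain vs where "3 \<le> length vs" "distinct vs" "edge ` X = cyclic_edges vs"
    using assms by (auto simp: grid_cycle_def)
  then show ?thesis
    using even_degree_cyclic_edges[of vs p] card_degree[where p = p and X = X] by simp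
qed

lemma signature_eq_iff:
  "signature n (edge ` X) = signature n (edge ` Z) \<longleftrightarrow>
    (\<forall>x y. 1 \<le> x \<longrightarrow> x < int n \<longrightarrow> 1 \<le> y \<longrightarrow> y < int n \<longrightarrow>
      hits X (sides (x, y)) = hits Z (sides (x, y)))"
proof -
  have "signature n (edge ` Y) = (\<lambda>p\<in>grid_cells n. hits Y (sides p))" for Y
    unfolding signature_def card_cell_edges ..
  then show ?thesis
    by (auto simp: grid_cells_def fun_eq_iff restrict_def simp del: sides.simps)
qed

lemma same_signature_crossed:
  assumes "grid_cycle n (edge ` X)" "grid_cycle n (edge ` Z)" "X \<subseteq> segments n" "Z \<subseteq> segments n"
    and sig: "signature n (edge ` X) = signature n (edge ` Z)"
  shows "\<exists>c. \<forall>e\<in>segments n. e \<in> Z \<longleftrightarrow> (e \<in> X) \<noteq> crossed n c e"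
proof -
  have "\<exists>c. \<forall>e\<in>segments n. ((e \<in> X) \<noteq> (e \<in> Z)) \<longleftrightarrow> crossed n c e"
  proof (rule bicycle_colouring)
    show "e \<in> segments n" if "(e \<in> X) \<noteq> (e \<in> Z)" for e
      using that assms(3,4) by auto
    show "even (hits {e. (e \<in> X) \<noteq> (e \<in> Z)} (star p))" for p
      unfolding even_hits_difference using assms(1,2) even_star_grid_cycle by simp
    show "even (hits {e. (e \<in> X) \<noteq> (e \<in> Z)} (sides (x, y)))"
      if "1 \<le> x" "x < int n" "1 \<le> y" "y < int n" for x y
      unfolding even_hits_difference using that sig[unfolded signature_eq_iff] by simp
  qed
  then show ?thesis
    by blast
qed

subsection \<open>The four cycles\<close>

fun move :: "char \<Rightarrow> point \<Rightarrow> point" where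
  "move m (x, y) = (if m = CHR ''R'' then (x + 1, y) else if m = CHR ''L'' then (x - 1, y)
     else if m = CHR ''U'' then (x, y + 1) else (x, y - 1))"

fun step :: "char \<Rightarrow> point \<Rightarrow> segment" where
  "step m (x, y) = (if m = CHR ''R'' then (False, x, y) else if m = CHR ''L'' then (False, x - 1, y)
     else if m = CHR ''U'' then (True, x, y) else (True, x, y - 1))"

fun walk :: "point \<Rightarrow> string \<Rightarrow> segment list" where
  "walk p [] = []"
| "walk p (m # ms) = step m p # walk (move m p) ms"

fun visits :: "point \<Rightarrow> string \<Rightarrow> point list" where
  "visits p [] = []"
| "visits p (m # ms) = p # visits (move m p) ms"

lemma step_cases:
  "snd (step m p) = p \<and> tip (step m p) = move m p \<or> snd (step m p) = move m p \<and> tip (step m p) = p"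
  by (cases p) auto

lemma walk_linked:
  "set (walk p ms) \<subseteq> X \<Longrightarrow> e \<in> set (walk p ms) \<Longrightarrow> (p, snd e) \<in> linked X"
proof (induction ms arbitrary: p)
  case (Cons m ms)
  have "step m p \<in> X"
    using Cons.prems(1) by simp
  then have link: "(p, move m p) \<in> linked X" "(p, snd (step m p)) \<in> linked X"
    using step_cases[of m p] linked_tip[of "step m p" X] linked_sym[of "move m p" p X] by auto
  show ?case
  proof (cases "e = step m p")
    case False
    then have "(move m p, snd e) \<in> linked X"
      using Cons by simp
    then show ?thesis
      using link(1) linked_trans by blast
  qed (use link in simp)
qed simp

section \<open>Degrees and cell counts of a walk as multiplicities in lists\<close>

definition ends :: "segment list \<Rightarrow> point list" where
  "ends es = concat (map (\<lambda>e. [snd e, tip e]) es)"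

definition cells_along :: "segment list \<Rightarrow> point list" where
  "cells_along es = concat (map (\<lambda>(v, x, y). [(x, y), if v then (x - 1, y) else (x, y - 1)]) es)"

lemma hits_set_Cons:
  assumes "e \<notin> set xs"
  shows "hits (set (e # xs)) es = hits (set xs) es + count (mset es) e"
  using assms by (induction es) (auto simp: hits_def)

text \<open>Double counting: \<open>e\<close> occurs in the star of \<open>p\<close> as often as
  \<open>p\<close> occurs among the ends of \<open>e\<close>.\<close>

lemma hits_star_count: "distinct xs \<Longrightarrow> hits (set xs) (star p) = count (mset (ends xs)) p"
proof (induction xs)
  case Nil
  then show ?case
    by (simp add: hits_def ends_def)
next
  case (Cons e xs)
  have "count (mset (star p)) e = count (mset [snd e, tip e]) p"
    by (cases e; cases p) auto
  then show ?case
    using Cons hits_set_Cons[of e xs "star p"] by (simp add: ends_def)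
qed

lemma hits_sides_count: "distinct xs \<Longrightarrow> hits (set xs) (sides p) = count (mset (cells_along xs)) p"
proof (induction xs)
  case Nil
  then show ?case
    by (simp add: hits_def cells_along_def)
next
  case (Cons e xs)
  have "count (mset (sides p)) e = count (mset (cells_along [e])) p"
    by (cases e; cases p) (auto simp: cells_along_def)
  then show ?case
    using Cons hits_set_Cons[of e xs "sides p"] by (simp add: cells_along_def)
qed

text \<open>Every move contributes the point it leaves and the point it enters. The points left are
  the visits; the points entered are the visits with the start exchanged for the final
  point.\<close>

lemma mset_ends_walk:
  "add_mset p (mset (ends (walk p ms))) =
    add_mset (fold move ms p) (mset (visits p ms) + mset (visits p ms))"
proof (induction ms arbitrary: p)
  case (Cons m ms)
  have "{#tip (step m p), snd (step m p)#} = {#move m p, p#}"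
    using step_cases[of m p] by (elim disjE conjE) (simp_all add: add_mset_commute)
  then have "mset (ends (walk p (m # ms))) = {#p, move m p#} + mset (ends (walk (move m p) ms))"
    by (simp add: ends_def)
  then show ?case
    using Cons[of "move m p"] by simp
qed (simp add: ends_def)

lemma hits_star_closed_walk:
  assumes "distinct (walk p ms)" "distinct (visits p ms)" "fold move ms p = p"
  shows "hits (set (walk p ms)) (star q) \<in> {0, 2}"
proof -
  have "mset (ends (walk p ms)) = mset (visits p ms) + mset (visits p ms)"
    using mset_ends_walk[of p ms] assms(3) by simp
  moreover have "count (mset (visits p ms)) q = (if q \<in> set (visits p ms) then 1 else 0)"
    using assms(2) unfolding distinct_count_atmost_1 by blast
  ultimately show ?thesis
    using assms(1) by (auto simp: hits_star_count)
qed

text \<open>The walk along \<open>route p q\<close> differs from the one along \<open>route False False\<close> by the colouring with value \<open>p\<close>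
  on the billiard paths 1 and 2, value \<open>p \<noteq> q\<close> on the path 3, and value \<open>False\<close> elsewhere.\<close>

definition route :: "bool \<Rightarrow> bool \<Rightarrow> string" where
  "route p q = (if p then
     (if q then ''RURRDRRRRRURURUUUUUULLLLLLDRRRRRDDLULLLLLLDRRRRRDDLU'' @
        ''LLLLLUUURRUURRRRRRRULLLLLLLLDDLLDDDDDRRRRRDDLULLLLDD''
      else ''RRRRRRRRURURUUUUULLLLLULDDRRRRRDLLLLLLULDDRRRRRDLLLL'' @
        ''LLUUUURRUURRRDRRRRUULDLLULLLLLDDLLDDDDDDRRRRRDLLLLLD'')
    else
     (if q then ''RUUUUUUURRUURRRDDDDDRDLLUUUUULDDDDDDRDLLUUUUULDDDDDD'' @
        ''RRRRRRURURUUUUULUURULLDDDDRDLLUUUUULLLLLDDLLDDDDDDDD''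
      else ''RRUUUULUUURRUURRRRDDDDDDLUUUUULLDRDDDDDDLUUUUULLDRDD'' @
        ''DDDRRRRRURURUUUUUUUULDDDDDLUUUUULLLLLLDDLLDDDDDRDDLD''))"

definition loop :: "bool \<Rightarrow> bool \<Rightarrow> segment list" where
  "loop p q = walk (1, 1) (route p q)"

lemma distinct_loop: "distinct (loop p q)"
  by (induct p; induct q; code_simp)

lemma distinct_visits_loop: "distinct (visits (1, 1) (route p q))"
  by (induct p; induct q; code_simp)

lemma loop_closed: "fold move (route p q) (1, 1) = (1, 1)"
  by (induct p; induct q; code_simp)

lemma loop_inside: "\<forall>(v, x, y)\<in>set (loop p q). 1 \<le> x \<and> 1 \<le> y \<and>
    (if v then x \<le> 11 \<and> y < 11 else x < 11 \<and> y \<le> 11)"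
  by (induct p; induct q; code_simp)

definition slice :: "int \<Rightarrow> int \<Rightarrow> segment list \<Rightarrow> segment list" where
  "slice a b es = filter (\<lambda>e. a \<le> level e \<and> level e \<le> b) es"

definition shifted :: "segment list \<Rightarrow> segment list" where
  "shifted es = map (\<lambda>(v, x, y). (v, x + 2, y + 2)) es"

text \<open>Sorting turns equality of multisets into equality of lists, which evaluation decides. A
  shift by (2, 2) raises the level by 4, from 9 to 13.\<close>

lemma loop_seam: "sort (shifted (slice 9 9 (loop p q))) = sort (slice 13 13 (loop p q))"
  by (induct p; induct q; code_simp)

text \<open>\<open>cells_along\<close> also lists the outer sides of border segments, which the
  signature ignores.\<close>

definition near_cells :: "segment list \<Rightarrow> point list" where
  "near_cells es = filter (\<lambda>(x, y). 1 \<le> x \<and> x \<le> 10 \<and> 1 \<le> y \<and> y \<le> 10) (cells_along es)"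

lemma loop_signature: "sort (near_cells (loop p q)) = sort (near_cells (loop False False))"
  by (induct p; induct q; code_simp)

definition far :: "segment list \<Rightarrow> segment list" where
  "far es = filter (\<lambda>(v, x, y). \<bar>x - y\<bar> > 5) es"

lemma loop_far: "sort (far (loop p q)) = sort (far (loop False False))"
  by (induct p; induct q; code_simp)

lemma loop_left: "\<forall>(v, x, y)\<in>set (loop False False). x \<le> 2 \<longrightarrow> y \<le> 9"
  by code_simp

lemma loop_parameters:
  "(True, 1, 2) \<in> set (loop p q) \<longleftrightarrow> q" "(False, 2, 2) \<in> set (loop p q) \<longleftrightarrow> p"
  by (induct p; induct q; code_simp)+

section \<open>A finite certificate for connectedness after stretching\<close>

definition lower_part :: "segment list \<Rightarrow> segment list" where
  "lower_part es = filter (\<lambda>e. level e < 13) es"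

text \<open>The shift of the levels 10 to 13 fills the levels 14 to 17, so this is the stretched set
  up to the level \<open>s + 4\<close> of \<open>stretch_connected\<close>, with
  \<open>s = 13\<close>.\<close>

definition lower_stretch :: "segment list \<Rightarrow> segment list" where
  "lower_stretch es = filter (\<lambda>e. level e \<le> 13) es @ shifted (slice 10 13 es)"

text \<open>For every segment \<open>c\<close> of level 13, the part of the lower segments reached from its lower end, and
  the part of the stretched lower segments that is not reached from the shift of that end.\<close>

definition probes :: "segment list \<Rightarrow> segment list \<Rightarrow> segment list \<Rightarrow>
    (segment \<times> segment list option \<times> segment list option) list" where
  "probes cs as es = map (\<lambda>c. (c,
    map_option (\<lambda>rs. filter (\<lambda>e. e \<notin> set rs) as) (explore 300 [snd c] as),
    explore 300 [shift (snd c)] es)) cs"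

text \<open>This checks hypothesis \<open>low\<close> of \<open>stretch_connected\<close>. An
  unfinished search counts as failure; the bound 300 is ample, since a loop on 121 points has at
  most 121 segments and \<open>lower_stretch\<close> at most doubles this.\<close>

fun reconnected :: "segment list \<Rightarrow> segment \<times> segment list option \<times> segment list option \<Rightarrow> bool" where
  "reconnected cs (c, Some as, Some rs) \<longleftrightarrow>
    (\<forall>(v, x, y)\<in>set cs. (x, y) \<in> set (snd c # ends as) \<longrightarrow> (v, x + 2, y + 2) \<notin> set rs)"
| "reconnected cs _ \<longleftrightarrow> False"

text \<open>This checks hypothesis \<open>new\<close> of \<open>stretch_connected\<close>. The value
  of \<open>the\<close> is meaningful because \<open>reconnected\<close> rejects
  \<open>None\<close>.\<close>

definition covered :: "segment list \<Rightarrow> (segment \<times> segment list option \<times> segment list option) list \<Rightarrow> bool" where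
  "covered es ps \<longleftrightarrow> (\<forall>e\<in>set es. \<exists>(c, as, rs)\<in>set ps. e \<notin> set (the rs))"

definition bridged :: "(segment \<times> segment list option \<times> segment list option) list \<Rightarrow>
    segment list \<Rightarrow> segment list \<Rightarrow> bool" where
  "bridged ps cs es \<longleftrightarrow> cs \<noteq> [] \<and> (\<forall>t\<in>set ps. reconnected cs t) \<and> covered es ps"

lemma loop_bridged:
  "bridged (probes (slice 13 13 (loop p q)) (lower_part (loop p q)) (lower_stretch (loop p q)))
    (slice 13 13 (loop p q)) (lower_stretch (loop p q))"
  by (induct p; induct q; code_simp)

text \<open>Here \<open>q\<close> is the colour of path 3 itself, unlike in \<open>route\<close>.
  The two parametrisations need not match, because in the end only the numbers of colourings and of
  cycles are compared.\<close>

definition hue :: "bool \<Rightarrow> bool \<Rightarrow> int \<Rightarrow> bool" where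
  "hue p q i \<longleftrightarrow> p \<and> i \<le> 2 \<or> q \<and> i = 3"

lemma mem_shifted: "(v, x, y) \<in> set (shifted es) \<longleftrightarrow> (v, x - 2, y - 2) \<in> set es"
  unfolding shifted_def by (force intro: image_eqI[of _ _ "(v, x - 2, y - 2)"])

lemma mem_slice: "e \<in> set (slice a b es) \<longleftrightarrow> e \<in> set es \<and> a \<le> level e \<and> level e \<le> b"
  by (auto simp: slice_def)

lemma mem_ends: "r \<in> set (ends es) \<longleftrightarrow> (\<exists>e\<in>set es. r = snd e \<or> r = tip e)"
  unfolding ends_def by (induction es) simp_all

lemma mset_cong_sort: "sort xs = sort ys \<Longrightarrow> mset xs = mset ys"
  by (metis mset_sort)

lemma seam_loop: "seam 13 (set (loop p q))"
  unfolding seam_def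
proof (intro allI impI)
  fix v and x y :: int
  assume xy: "x + y = 13"
  have "set (slice 13 13 (loop p q)) = set (shifted (slice 9 9 (loop p q)))"
    using mset_cong_sort[OF loop_seam] by (metis set_mset_mset)
  then have "(v, x, y) \<in> set (slice 13 13 (loop p q)) \<longleftrightarrow> (v, x - 2, y - 2) \<in> set (slice 9 9 (loop p q))"
    by (simp only: mem_shifted)
  then show "(v, x, y) \<in> set (loop p q) \<longleftrightarrow> (v, x - 2, y - 2) \<in> set (loop p q)"
    using xy by (simp add: mem_slice)
qed

section \<open>The infinite family of cycles\<close>

primrec family :: "bool \<Rightarrow> bool \<Rightarrow> nat \<Rightarrow> segment set" where
  "family p q 0 = set (loop p q)"
| "family p q (Suc k) = stretch 13 (family p q k)"

lemma family_low: "x + y \<le> 13 \<Longrightarrow> (v, x, y) \<in> family p q k \<longleftrightarrow> (v, x, y) \<in> set (loop p q)"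
  by (induction k) (simp_all add: stretch_low)

lemma seam_family: "seam 13 (family p q k)"
  by (induction k) (simp_all add: seam_loop seam_stretch)

lemma family_subset: "family p q k \<subseteq> segments (11 + 2 * k)"
proof (induction k)
  case 0
  then show ?case
    using loop_inside[of p q] by (auto simp: mem_segments)
next
  case (Suc k)
  from stretch_subset_segments[OF this, of 13] show ?case
    by simp
qed

lemma family_degree: "hits (family p q k) (star r) \<in> {0, 2}"
proof (induction k arbitrary: r)
  case 0
  show ?case
    unfolding family.simps loop_def
    by (intro hits_star_closed_walk) (use distinct_loop distinct_visits_loop loop_closed in \<open>auto simp: loop_def\<close>)
next
  case (Suc k)
  obtain x y where r: "r = (x, y)"
    by (cases r)
  show ?case
    unfolding r family.simps hits_star_stretch[OF seam_family] using Suc .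
qed

lemma set_lower_stretch:
  assumes agree: "\<And>v x y. x + y \<le> 13 \<Longrightarrow> (v, x, y) \<in> X \<longleftrightarrow> (v, x, y) \<in> set es"
  shows "e \<in> set (lower_stretch es) \<longleftrightarrow> e \<in> stretch 13 X \<and> level e \<le> 17"
proof -
  obtain v x y where e: "e = (v, x, y)"
    by (cases e)
  have mem: "e \<in> set (lower_stretch es) \<longleftrightarrow> (v, x, y) \<in> set es \<and> x + y \<le> 13 \<or>
      (v, x - 2, y - 2) \<in> set es \<and> 10 \<le> x + y - 4 \<and> x + y - 4 \<le> 13"
    by (auto simp: e lower_stretch_def mem_shifted mem_slice)
  show ?thesis
  proof (cases "x + y \<le> 13")
    case True
    then show ?thesis
      unfolding mem using agree by (auto simp: e stretch_def)
  next
    case False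
    then show ?thesis
      unfolding mem using agree[of "x - 2" "y - 2" v] by (auto simp: e stretch_def)
  qed
qed

text \<open>The levels up to 17 of the stretched set depend only on the levels up to 13 of
  \<open>X\<close>, and these agree with the loop at every stage. So the single check
  \<open>loop_bridged\<close> serves the whole induction.\<close>

lemma stretch_loop_connected:
  assumes agree: "\<And>v x y. x + y \<le> 13 \<Longrightarrow> (v, x, y) \<in> X \<longleftrightarrow> (v, x, y) \<in> set (loop p q)"
    and seam: "seam 13 X"
    and conn: "\<And>a b. a \<in> X \<Longrightarrow> b \<in> X \<Longrightarrow> (snd a, snd b) \<in> linked X"
    and ab: "a \<in> stretch 13 X" "b \<in> stretch 13 X"
  shows "(snd a, snd b) \<in> linked (stretch 13 X)"
proof -
  define cs where "cs = slice 13 13 (loop p q)"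
  define as where "as = lower_part (loop p q)"
  define es where "es = lower_stretch (loop p q)"
  have bridged: "cs \<noteq> []" "\<And>t. t \<in> set (probes cs as es) \<Longrightarrow> reconnected cs t" "covered es (probes cs as es)"
    using loop_bridged[of p q] unfolding bridged_def cs_def as_def es_def by auto
  have cs: "e \<in> set cs \<longleftrightarrow> e \<in> X \<and> level e = 13" for e
    using agree by (cases e) (auto simp: cs_def mem_slice)
  have as: "set as = {e \<in> X. level e < 13}"
    using agree by (auto simp: as_def lower_part_def)
  have es: "e \<in> set es \<longleftrightarrow> e \<in> stretch 13 X \<and> level e \<le> 17" for e
    unfolding es_def using agree by (rule set_lower_stretch)
  have probe: "\<exists>us rs. explore 300 [snd c] as = Some us \<and> explore 300 [shift (snd c)] es = Some rs \<and>
      reconnected cs (c, Some (filter (\<lambda>e. e \<notin> set us) as), Some rs)" if "c \<in> set cs" for c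
  proof -
    have "reconnected cs (c, map_option (\<lambda>rs. filter (\<lambda>e. e \<notin> set rs) as) (explore 300 [snd c] as),
        explore 300 [shift (snd c)] es)"
      using that by (intro bridged(2)) (simp add: probes_def)
    then show ?thesis
      by (cases "explore 300 [snd c] as"; cases "explore 300 [shift (snd c)] es") auto
  qed
  have reach: "(shift (snd c), snd e) \<in> linked (stretch 13 X)"
    if "explore 300 [shift (snd c)] es = Some rs" "e \<in> set es" "e \<notin> set rs" for c e rs
  proof -
    have "set es \<subseteq> stretch 13 X"
      using es by blast
    then show ?thesis
      using explore_linked[OF that(1), of "stretch 13 X" e] that(2,3) by auto
  qed
  obtain c where c: "c \<in> set cs"
    using bridged(1) by (cases cs) auto
  show ?thesis
  proof (rule stretch_connected[OF seam conn _ _ _ _ ab])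
    show "c \<in> X" "level c = 13"
      using c cs by auto
  next
    fix a b
    assume a: "a \<in> X" "level a = 13" and b: "b \<in> X" "level b = 13"
      and link: "(snd a, snd b) \<in> linked {e \<in> X. level e < 13}"
    obtain us rs where a_probe: "explore 300 [snd a] as = Some us" "explore 300 [shift (snd a)] es = Some rs"
        "reconnected cs (a, Some (filter (\<lambda>e. e \<notin> set us) as), Some rs)"
      using probe[of a] a cs by auto
    have "snd b = snd a \<or> (\<exists>e\<in>set as - set us. snd b = snd e \<or> snd b = tip e)"
      using explore_complete[OF a_probe(1)] link unfolding as[symmetric] .
    then have "snd b \<in> set (snd a # ends (filter (\<lambda>e. e \<notin> set us) as))"
      unfolding list.set mem_ends insert_iff set_filter by blast
    moreover obtain v x y where b_eq: "b = (v, x, y)"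
      by (cases b)
    moreover have "b \<in> set cs"
      using b cs by simp
    ultimately have "(v, x + 2, y + 2) \<notin> set rs"
      using a_probe(3) by auto
    moreover have "(v, x + 2, y + 2) \<in> set es"
      using b b_eq seam by (simp add: es stretch_high)
    ultimately show "(shift (snd a), shift (snd b)) \<in> linked (stretch 13 X)"
      using reach[OF a_probe(2)] b_eq by fastforce
  next
    fix e
    assume "e \<in> stretch 13 X" "level e \<le> 13 + 4"
    then have e: "e \<in> set es"
      by (simp add: es)
    then obtain c ms where c: "c \<in> set cs" "ms = explore 300 [shift (snd c)] es" "e \<notin> set (the ms)"
      using bridged(3) unfolding covered_def probes_def by fastforce
    then obtain rs where "ms = Some rs"
      using probe[of c] by auto
    then have "(shift (snd c), snd e) \<in> linked (stretch 13 X)"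
      using reach[of c rs e] c e by simp
    then show "\<exists>a\<in>X. level a = 13 \<and> (shift (snd a), snd e) \<in> linked (stretch 13 X)"
      using c(1) cs by blast
  qed
qed

lemma family_connected: "a \<in> family p q k \<Longrightarrow> b \<in> family p q k \<Longrightarrow> (snd a, snd b) \<in> linked (family p q k)"
proof (induction k arbitrary: a b)
  case 0
  have "((1, 1), snd e) \<in> linked (set (loop p q))" if "e \<in> set (loop p q)" for e
    using walk_linked[of "(1, 1)" "route p q" "set (loop p q)" e] that by (simp add: loop_def)
  then show ?case
    using 0 linked_trans[OF linked_sym] unfolding family.simps by metis
next
  case (Suc k)
  show ?case
    unfolding family.simps
  proof (rule stretch_loop_connected)
    show "(v, x, y) \<in> family p q k \<longleftrightarrow> (v, x, y) \<in> set (loop p q)" if "x + y \<le> 13" for v x y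
      using that by (rule family_low)
    show "(snd a, snd b) \<in> linked (family p q k)" if "a \<in> family p q k" "b \<in> family p q k" for a b
      using that by (rule Suc.IH)
  qed (use Suc.prems seam_family in simp_all)
qed

lemma grid_cycle_family: "grid_cycle (11 + 2 * k) (edge ` family p q k)"
proof (rule grid_cycle_edge_image[OF family_subset _ family_degree family_connected])
  have "slice 13 13 (loop p q) \<noteq> []"
    using loop_bridged[of p q] by (simp add: bridged_def)
  then obtain e where "e \<in> set (slice 13 13 (loop p q))"
    using list.set_sel(1) by blast
  then show "family p q k \<noteq> {}"
    using family_low[of "fst (snd e)" "snd (snd e)" "fst e" p q k] by (auto simp: mem_slice)
qed

lemma far_family:
  "5 < \<bar>x - y\<bar> \<Longrightarrow> (v, x, y) \<in> family p q k \<longleftrightarrow> (v, x, y) \<in> family False False k"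
proof (induction k arbitrary: x y)
  case 0
  have "set (far (loop p q)) = set (far (loop False False))"
    using mset_cong_sort[OF loop_far] by (metis set_mset_mset)
  then have "(v, x, y) \<in> set (far (loop p q)) \<longleftrightarrow> (v, x, y) \<in> set (far (loop False False))"
    by simp
  then show ?case
    using 0 by (simp add: far_def)
next
  case (Suc k)
  then show ?case
    by (simp add: stretch_def)
qed

text \<open>The bound 6 keeps the cell used by the induction inside the smaller grid, whether it is
  shifted back or not. A cell such as (11, 1) of the first enlarged grid would leave it; beyond the
  bound all sides of a cell fall under \<open>far_family\<close>.\<close>

lemma near_family:
  assumes "\<bar>x - y\<bar> \<le> 6" "1 \<le> x" "x \<le> 10 + 2 * int k" "1 \<le> y" "y \<le> 10 + 2 * int k"
  shows "hits (family p q k) (sides (x, y)) = hits (family False False k) (sides (x, y))"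
  using assms
proof (induction k arbitrary: x y)
  case 0
  have near: "count (mset (cells_along (loop p q))) (x, y) = count (mset (near_cells (loop p q))) (x, y)" for p q
    using 0 by (simp add: near_cells_def)
  show ?case
    unfolding family.simps hits_sides_count[OF distinct_loop] near
    by (rule arg_cong[OF mset_cong_sort[OF loop_signature]])
next
  case (Suc k)
  show ?case
    unfolding family.simps hits_sides_stretch[OF seam_family]
    using Suc.IH[of x y] Suc.IH[of "x - 2" "y - 2"] Suc.prems by (auto simp del: sides.simps)
qed

lemma signature_family:
  "signature (11 + 2 * k) (edge ` family p q k) = signature (11 + 2 * k) (edge ` family False False k)"
  unfolding signature_eq_iff
proof (intro allI impI)
  fix x y :: int
  assume "1 \<le> x" "x < int (11 + 2 * k)" "1 \<le> y" "y < int (11 + 2 * k)"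
  then show "hits (family p q k) (sides (x, y)) = hits (family False False k) (sides (x, y))"
    using near_family[of x y k p q] far_family[of _ _ _ p q k]
    by (cases "\<bar>x - y\<bar> \<le> 6") (auto simp: hits_def)
qed

text \<open>Segments above level 13 have been shifted to x >= 3, so nothing new enters the columns x
  <= 2.\<close>

lemma family_left: "(v, x, y) \<in> family False False k \<Longrightarrow> x \<le> 2 \<Longrightarrow> y \<le> 9"
proof (induction k)
  case 0
  then show ?case
    using loop_left by auto
next
  case (Suc k)
  show ?case
  proof (cases "x + y \<le> 13")
    case True
    then show ?thesis
      using Suc by (simp add: stretch_low)
  next
    case False
    then have "(v, x - 2, y - 2) \<in> segments (11 + 2 * k)"
      using Suc.prems family_subset by (auto simp: stretch_def)
    then show ?thesis
      using Suc.prems by (simp add: mem_segments)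
  qed
qed

subsection \<open>Excluding further colourings\<close>

text \<open>These are the sides of the seven cells that \<open>corner_colouring\<close>
  inspects.\<close>

lemma loop_corner:
  "list_all (\<lambda>e. e \<in> set (loop False False))
    [(False, 1, 1), (False, 1, 2), (True, 1, 1), (False, 1, 4), (True, 2, 3), (False, 2, 5), (True, 3, 4),
     (True, 3, 1), (True, 4, 1), (True, 4, 2), (True, 5, 2), (False, 6, 1), (False, 7, 1)]"
  "list_all (\<lambda>e. e \<notin> set (loop False False))
    [(True, 2, 1), (False, 1, 3), (True, 1, 3), (False, 2, 4), (True, 2, 4), (False, 3, 1), (False, 3, 2),
     (False, 4, 2), (False, 4, 3), (False, 6, 2), (True, 6, 1), (True, 7, 1), (False, 7, 2), (True, 8, 1)]"
  by code_simp+

lemma corner_colouring: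
  assumes n: "11 \<le> n"
    and Z: "\<And>e. e \<in> segments n \<Longrightarrow> e \<in> Z \<longleftrightarrow> (e \<in> family False False k) \<noteq> crossed n c e"
    and hits: "\<And>x y. 1 \<le> x \<Longrightarrow> x < int n \<Longrightarrow> 1 \<le> y \<Longrightarrow> y < int n \<Longrightarrow>
      hits (family False False k) (sides (x, y)) = hits Z (sides (x, y))"
  shows "c 1 = c 2" "c 4 = c 9" "c 5 = c 9" "c 6 = c 9" "c 7 = c 9" "c 8 = c 9"
proof -
  note corner = loop_corner[simplified]
  have Z': "(v, x, y) \<in> Z \<longleftrightarrow> ((v, x, y) \<in> set (loop False False)) \<noteq>
      (c (x + y) \<noteq> c (mirror n (if v then x - y else x - y + 1)))"
    if "1 \<le> x" "1 \<le> y" "x + y \<le> 10" for v x y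
    using Z[of "(v, x, y)"] family_low[of x y v False False k] that n
    by (simp add: mem_segments mirror_def)
  have m: "mirror n i = (if i < 1 then 1 - i else i)" if "i \<le> 10" for i
    using n that by (simp add: mirror_def)
  have cell: "hits (set (loop False False)) (sides (x, y)) = hits Z (sides (x, y))"
    if "1 \<le> x" "1 \<le> y" "x + y \<le> 10" for x y
    using hits[of x y] that n by (simp add: hits_def family_low)
  \<comment> \<open>The bottom and left sides of cell (1, 1) are both present and would both vanish
    if \<open>c 1\<close> and \<open>c 2\<close> differed. The top and right sides, one present and
    one absent, are at most exchanged and cannot compensate.\<close>
  have "c 1 = c 2"
    using cell[of 1 1] by (cases "c 1"; cases "c 2"; cases "c 3") (simp_all add: hits_def Z' m corner)
  \<comment> \<open>The mirror-image cells (1, 3) and (3, 1) involve the same four colours; one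
    settles the case \<open>c 2 = c 3\<close>, the other its negation. So \<open>c 3\<close> itself
    stays free. The cells (2, 4) and (4, 2) do the same for \<open>c 6\<close> and
    \<open>c 7\<close>.\<close>
  have "c 2 = c 3 \<Longrightarrow> c 4 = c 5"
    using cell[of 1 3] by (cases "c 2"; cases "c 3"; cases "c 4"; cases "c 5") (simp_all add: hits_def Z' m corner)
  moreover have "c 2 \<noteq> c 3 \<Longrightarrow> c 4 = c 5"
    using cell[of 3 1] by (cases "c 2"; cases "c 3"; cases "c 4"; cases "c 5") (simp_all add: hits_def Z' m corner)
  ultimately have "c 4 = c 5"
    by blast
  have "c 2 = c 3 \<Longrightarrow> c 6 = c 7"
    using cell[of 2 4] by (cases "c 2"; cases "c 3"; cases "c 6"; cases "c 7") (simp_all add: hits_def Z' m corner)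
  moreover have "c 2 \<noteq> c 3 \<Longrightarrow> c 6 = c 7"
    using cell[of 4 2] by (cases "c 2"; cases "c 3"; cases "c 6"; cases "c 7") (simp_all add: hits_def Z' m corner)
  ultimately have "c 6 = c 7"
    by blast
  \<comment> \<open>The bottom side is the only one present in cell (6, 1), and it stays if
    \<open>c 6 = c 7\<close>. Hence no absent side may enter.\<close>
  moreover have "c 6 = c 7 \<Longrightarrow> c 5 = c 6 \<and> c 8 = c 6"
    using cell[of 6 1] by (cases "c 5"; cases "c 6"; cases "c 7"; cases "c 8") (simp_all add: hits_def Z' m corner)
  moreover have "c 6 = c 7 \<Longrightarrow> c 9 = c 7"
    using cell[of 7 1] by (cases "c 6"; cases "c 7"; cases "c 8"; cases "c 9") (simp_all add: hits_def Z' m corner)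
  ultimately show "c 1 = c 2" "c 4 = c 9" "c 5 = c 9" "c 6 = c 9" "c 7 = c 9" "c 8 = c 9"
    using \<open>c 1 = c 2\<close> \<open>c 4 = c 5\<close> by simp_all
qed

lemma border_colouring:
  assumes n: "n = 11 + 2 * k"
    and Z: "\<And>e. e \<in> segments n \<Longrightarrow> e \<in> Z \<longleftrightarrow> (e \<in> family False False k) \<noteq> crossed n c e"
    and hits: "\<And>x y. 1 \<le> x \<Longrightarrow> x < int n \<Longrightarrow> 1 \<le> y \<Longrightarrow> y < int n \<Longrightarrow>
      hits (family False False k) (sides (x, y)) = hits Z (sides (x, y))"
    and i: "9 \<le> i" "i \<le> int n"
  shows "c i = c 9"
proof -
  \<comment> \<open>An empty cell has no side in \<open>Z\<close> either. After reflection at the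
    left border, the paths y + 1 and y - 1 cross on the bottom side of cell (1, y), and the paths y
    + 1 and y on its left side.\<close>
  have equal: "c (y + 1) = c (y - 1) \<and> c (y + 1) = c y" if y: "10 \<le> y" "y < int n" for y
  proof -
    have out: "(v, x, y') \<notin> family False False k" if "x \<le> 2" "y \<le> y'" for v x y'
      using family_left[of v x y' k] that y by auto
    have "hits (family False False k) (sides (1, y)) = 0"
      by (simp add: hits_def out)
    then have "hits Z (sides (1, y)) = 0"
      using hits[of 1 y] y by simp
    then have "(False, 1, y) \<notin> Z" "(True, 1, y) \<notin> Z"
      by (auto simp: hits_def)
    then show ?thesis
      using Z[of "(False, 1, y)"] Z[of "(True, 1, y)"] out[of 1 y] y
      by (simp add: mem_segments mirror_def algebra_simps)
  qed
  show ?thesis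
    using i
  proof (induction i rule: int_ge_induct)
    case (step i)
    show ?case
    proof (cases "i = 9")
      case True
      \<comment> \<open>Cell (1, 9) is not known to be empty, so the step from 9 to 10 combines both
        equations of cell (1, 10).\<close>
      then show ?thesis
        using equal[of 10] n by auto
    next
      case False
      then show ?thesis
        using equal[of i] step by auto
    qed
  qed simp
qed

lemma mirror_range:
  assumes "(v, x, y) \<in> segments n"
  shows "mirror n (x + y) \<in> {1..int n}" "mirror n (if v then x - y else x - y + 1) \<in> {1..int n}"
  using assms by (auto simp: mem_segments mirror_def split: if_splits)

lemma same_signature_cases:
  assumes n: "n = 11 + 2 * k"
    and cycle: "grid_cycle n (edge ` Z)" and sub: "Z \<subseteq> segments n"
    and sig: "signature n (edge ` Z) = signature n (edge ` family False False k)"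
  shows "\<exists>p q. Z = {e \<in> segments n. (e \<in> family False False k) \<noteq> crossed n (hue p q) e}"
proof -
  let ?X = "family False False k"
  have "\<exists>c. \<forall>e\<in>segments n. e \<in> Z \<longleftrightarrow> (e \<in> ?X) \<noteq> crossed n c e"
  proof (rule same_signature_crossed[OF _ cycle _ sub sig[symmetric]])
    show "grid_cycle n (edge ` ?X)" "?X \<subseteq> segments n"
      unfolding n by (rule grid_cycle_family family_subset)+
  qed
  then obtain c where c: "\<And>e. e \<in> segments n \<Longrightarrow> e \<in> Z \<longleftrightarrow> (e \<in> ?X) \<noteq> crossed n c e"
    by blast
  have hits: "hits ?X (sides (x, y)) = hits Z (sides (x, y))"
    if "1 \<le> x" "x < int n" "1 \<le> y" "y < int n" for x y
    using sig[unfolded signature_eq_iff] that by simp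
  note corner = corner_colouring[OF _ c hits] border_colouring[OF n c hits]
  \<comment> \<open>Complementing all colours does not change \<open>crossed\<close>, so path 9 may
    be given the colour \<open>False\<close>.\<close>
  define p q where "p \<longleftrightarrow> c 1 \<noteq> c 9" and "q \<longleftrightarrow> c 3 \<noteq> c 9"
  have hue: "hue p q i \<longleftrightarrow> c i \<noteq> c 9" if i: "i \<in> {1..int n}" for i
  proof (cases "9 \<le> i")
    case True
    then show ?thesis
      using corner(7)[of i] i by (simp add: hue_def)
  next
    case False
    then have "i \<in> {1, 2, 3, 4, 5, 6, 7, 8}"
      using i by auto
    then show ?thesis
      using corner(1-6) by (auto simp: hue_def p_def q_def n)
  qed
  have "crossed n (hue p q) e \<longleftrightarrow> crossed n c e" if "e \<in> segments n" for e
  proof -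
    obtain v x y where e: "e = (v, x, y)"
      by (cases e)
    then show ?thesis
      using mirror_range[of v x y n] that by (auto simp: hue)
  qed
  then have "Z = {e \<in> segments n. (e \<in> ?X) \<noteq> crossed n (hue p q) e}"
    using c sub by auto
  then show ?thesis
    by blast
qed

theorem proposition2:
  fixes n0 :: nat
  assumes "n0 > 0"
  shows "\<exists>n\<ge>n0. \<exists>C. grid_cycle n C \<and> signature_multiplicity n (signature n C) = 4"
proof -
  define n where "n = 11 + 2 * n0"
  define C where "C = edge ` family False False n0"
  define A where "A = {D. grid_cycle n D \<and> signature n D = signature n C}"
  \<comment> \<open>The values of \<open>f\<close> include all of \<open>A\<close>, with no claim
    that each is a cycle; \<open>g\<close> provides four distinct members of
    \<open>A\<close>.\<close>
  define f where "f = (\<lambda>(p, q). edge ` {e \<in> segments n. (e \<in> family False False n0) \<noteq> crossed n (hue p q) e})"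
  define g where "g = (\<lambda>(p, q). edge ` family p q n0)"
  have "A \<subseteq> range f"
  proof
    fix D
    assume D: "D \<in> A"
    then have "D \<subseteq> edge ` segments n"
      by (simp add: A_def grid_cycle_def grid_edges_eq)
    then obtain Z where Z: "Z \<subseteq> segments n" "D = edge ` Z"
      by (auto simp: subset_image_iff)
    have "grid_cycle n (edge ` Z)" "signature n (edge ` Z) = signature n (edge ` family False False n0)"
      using D by (simp_all add: A_def C_def Z)
    then obtain p q where "Z = {e \<in> segments n. (e \<in> family False False n0) \<noteq> crossed n (hue p q) e}"
      using same_signature_cases[OF n_def _ Z(1)] by blast
    then have "D = f (p, q)"
      by (simp add: f_def Z)
    then show "D \<in> range f"
      by blast
  qed
  moreover have "finite (range f)"
    by simp
  ultimately have fin: "finite A" and "card A \<le> card (range f)"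
    by (auto intro: finite_subset card_mono)
  moreover have four: "card (UNIV :: (bool \<times> bool) set) = 4"
    by (simp add: card_cartesian_product flip: UNIV_Times_UNIV)
  ultimately have upper: "card A \<le> 4"
    using card_image_le[of UNIV f] by simp
  have "range g \<subseteq> A"
    using grid_cycle_family signature_family by (auto simp: g_def A_def C_def n_def)
  moreover have "inj g"
  proof (rule injI)
    fix a b
    assume "g a = g b"
    then have "family (fst a) (snd a) n0 = family (fst b) (snd b) n0"
      by (simp add: g_def case_prod_beta inj_image_eq_iff[OF inj_edge])
    moreover have "(True, 1, 2) \<in> family p q n0 \<longleftrightarrow> q" "(False, 2, 2) \<in> family p q n0 \<longleftrightarrow> p" for p q
      by (simp_all add: family_low loop_parameters)
    ultimately show "a = b"
      by (metis prod_eqI)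
  qed
  ultimately have "4 \<le> card A"
    using card_mono[OF fin, of "range g"] card_image[of g UNIV] four by simp
  with upper have "card A = 4"
    by simp
  moreover have "grid_cycle n C"
    using grid_cycle_family unfolding C_def n_def .
  moreover have "n0 \<le> n"
    by (simp add: n_def)
  ultimately show ?thesis
    unfolding signature_multiplicity_def A_def by blast
qed

end
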